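(* Let $R$ be an abelian ring. Then $R$ is regularly nil clean if and only if $R$ is D-regularly nil clean.
   Context: All rings are associative with identity (not necessarily commutative). A ring is called abelian if all its idempotents are central. A ring $R$ is called regularly nil clean if for every $a\in R$ there exists an idempotent $e\in Ra$ such that $a(1-e)$ is nilpotent. A ring $R$ is called D-regularly nil clean if for every $a\in R$ there exists an idempotent $e\in aRa$ such that $a(1-e)$ is nilpotent. *)

theory Defs
  imports "HOL-Algebra.Ring"
begin

text \<open>Rings are records satisfying the HOL-Algebra locale \<open>ring\<close>: associative, with identity, not
  necessarily commutative; the zero ring is included.\<close>

definition ring_idempotent :: "('a, 'm) ring_scheme \<Rightarrow> 'a \<Rightarrow> bool" where
  "ring_idempotent R e \<longleftrightarrow> e \<in> carrier R \<and> e \<otimes>\<^bsub>R\<^esub> e = e"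

definition ring_nilpotent :: "('a, 'm) ring_scheme \<Rightarrow> 'a \<Rightarrow> bool" where
  "ring_nilpotent R x \<longleftrightarrow> x \<in> carrier R \<and> (\<exists>n::nat. n > 0 \<and> x [^]\<^bsub>R\<^esub> n = \<zero>\<^bsub>R\<^esub>)"

definition ring_central :: "('a, 'm) ring_scheme \<Rightarrow> 'a \<Rightarrow> bool" where
  "ring_central R x \<longleftrightarrow> x \<in> carrier R \<and> (\<forall>y\<in>carrier R. x \<otimes>\<^bsub>R\<^esub> y = y \<otimes>\<^bsub>R\<^esub> x)"

text \<open>\<open>Abelian\<close> in the sense of noncommutative ring theory; unrelated to the locales
  \<open>abelian_group\<close> and \<open>abelian_monoid\<close>, which concern the additive structure.\<close>

definition idempotents_central :: "('a, 'm) ring_scheme \<Rightarrow> bool" where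
  "idempotents_central R \<longleftrightarrow> (\<forall>e. ring_idempotent R e \<longrightarrow> ring_central R e)"

definition regularly_nil_clean :: "('a, 'm) ring_scheme \<Rightarrow> bool" where
  "regularly_nil_clean R \<longleftrightarrow>
     (\<forall>a\<in>carrier R. \<exists>e\<in>{r \<otimes>\<^bsub>R\<^esub> a | r. r \<in> carrier R}.
        ring_idempotent R e \<and> ring_nilpotent R (a \<otimes>\<^bsub>R\<^esub> (\<one>\<^bsub>R\<^esub> \<ominus>\<^bsub>R\<^esub> e)))"

definition D_regularly_nil_clean :: "('a, 'm) ring_scheme \<Rightarrow> bool" where
  "D_regularly_nil_clean R \<longleftrightarrow>
     (\<forall>a\<in>carrier R. \<exists>e\<in>{a \<otimes>\<^bsub>R\<^esub> r \<otimes>\<^bsub>R\<^esub> a | r. r \<in> carrier R}.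
        ring_idempotent R e \<and> ring_nilpotent R (a \<otimes>\<^bsub>R\<^esub> (\<one>\<^bsub>R\<^esub> \<ominus>\<^bsub>R\<^esub> e)))"

end

theory Submission
  imports Defs
begin

text \<open>Let \<open>e = r a\<close> be idempotent in an abelian ring. Then \<open>g = a e r\<close> is again idempotent, hence
  central, so \<open>e = r g a = g r a = g e = a r e = a r\<^sup>2 a\<close>. Thus the idempotent witnessing regular
  nil cleanness at \<open>a\<close> already lies in \<open>a R a\<close>.\<close>

lemma idempotents_centralD:
  assumes "idempotents_central R" and "ring_idempotent R e" and "y \<in> carrier R"
  shows "e \<otimes>\<^bsub>R\<^esub> y = y \<otimes>\<^bsub>R\<^esub> e"
  using assms unfolding idempotents_central_def ring_central_def by blast

lemma (in ring) idempotent_left_multiple_two_sided: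
  assumes central: "idempotents_central R"
    and a: "a \<in> carrier R" and r: "r \<in> carrier R"
    and idem: "ring_idempotent R (r \<otimes> a)"
  shows "r \<otimes> a = a \<otimes> (r \<otimes> r) \<otimes> a"
proof -
  define e where "e = r \<otimes> a"
  \<comment> \<open>The inner \<open>e\<close> secures idempotency: \<open>a \<otimes> r\<close>
    alone need not be idempotent, whereas its square and its cube both equal
    \<open>g\<close>.\<close>
  define g where "g = a \<otimes> (e \<otimes> r)"
  have ec: "e \<in> carrier R" and ee: "e \<otimes> e = e"
    using idem by (auto simp: e_def ring_idempotent_def)
  have gc: "g \<in> carrier R"
    using a r ec by (simp add: g_def)
  have "g \<otimes> g = a \<otimes> (e \<otimes> ((r \<otimes> a) \<otimes> (e \<otimes> r)))"
    using a r ec by (simp add: g_def m_assoc)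
  also have "\<dots> = a \<otimes> ((e \<otimes> e \<otimes> e) \<otimes> r)"
    using r ec by (simp add: m_assoc flip: e_def)
  finally have "ring_idempotent R g"
    using gc by (simp add: ee ring_idempotent_def flip: g_def)
  then have gr: "g \<otimes> r = r \<otimes> g"
    using idempotents_centralD[OF central] r by blast
  have er: "e \<otimes> r = r \<otimes> e"
    using idempotents_centralD[OF central] idem r by (simp add: e_def)
  \<comment> \<open>Writing \<open>e\<close> as a product of three copies of itself and expanding
    the outer two as \<open>r \<otimes> a\<close> exposes \<open>g\<close> in the middle.\<close>
  have "e = (r \<otimes> a) \<otimes> (e \<otimes> (r \<otimes> a))"
    by (simp add: ee flip: e_def)
  also have "\<dots> = (r \<otimes> g) \<otimes> a"
    using a r ec by (simp add: g_def m_assoc)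
  also have "\<dots> = g \<otimes> (r \<otimes> a)"
    using a r gc by (simp add: m_assoc flip: gr)
  \<comment> \<open>Centrality of \<open>e\<close> moves it to the right of \<open>r\<close>;
    expanding the final \<open>e\<close> then supplies the right-hand factor
    \<open>a\<close>.\<close>
  also have "\<dots> = a \<otimes> (r \<otimes> (e \<otimes> e))"
    using a r ec by (simp add: g_def er m_assoc flip: e_def)
  also have "\<dots> = a \<otimes> (r \<otimes> r) \<otimes> a"
    using a r by (simp only: ee) (simp add: e_def m_assoc)
  finally show ?thesis
    by (simp add: e_def)
qed

theorem theorem3p4:
  fixes R :: "('a, 'm) ring_scheme"
  assumes "ring R" and "idempotents_central R"
  shows "regularly_nil_clean R \<longleftrightarrow> D_regularly_nil_clean R"
proof -
  interpret ring R by fact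
  \<comment> \<open>The two notions differ only in the set from which \<open>e\<close> is drawn, so
    it suffices that both sets contain the same idempotents; the nilpotency condition is carried
    along unchanged.\<close>
  have "e \<in> {a \<otimes>\<^bsub>R\<^esub> r \<otimes>\<^bsub>R\<^esub> a | r. r \<in> carrier R} \<longleftrightarrow> e \<in> {r \<otimes>\<^bsub>R\<^esub> a | r. r \<in> carrier R}"
    if a: "a \<in> carrier R" and e: "ring_idempotent R e" for a e
  proof
    assume "e \<in> {a \<otimes>\<^bsub>R\<^esub> r \<otimes>\<^bsub>R\<^esub> a | r. r \<in> carrier R}"
    \<comment> \<open>Here \<open>a \<otimes> r\<close> serves as the left coefficient of
      \<open>a\<close>.\<close>
    then show "e \<in> {r \<otimes>\<^bsub>R\<^esub> a | r. r \<in> carrier R}"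
      using a by blast
  next
    assume "e \<in> {r \<otimes>\<^bsub>R\<^esub> a | r. r \<in> carrier R}"
    then obtain r where "r \<in> carrier R" and "e = r \<otimes>\<^bsub>R\<^esub> a"
      by blast
    then show "e \<in> {a \<otimes>\<^bsub>R\<^esub> r \<otimes>\<^bsub>R\<^esub> a | r. r \<in> carrier R}"
      using idempotent_left_multiple_two_sided[OF assms(2) a] e by blast
  qed
  then show ?thesis
    unfolding regularly_nil_clean_def D_regularly_nil_clean_def Bex_def by blast
qed

end
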